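(* Let $X$ be a non-zero separable real Banach space, let $Y$ be a real Banach space and let $T:X\longrightarrow Y$ be a narrow operator. Then for every $y\in B_X$ and every sequence $\{g_n:n\in\mathbb N\}\subseteq S_{X^*}$ there exists $u\in S_{X^{**}}$ such that (1) $\|x+u\|=1+\|x\|$ for every $x\in X$, (2) $T^{**}(u)=T(y)$, and (3) $u(g_n)=g_n(y)$ for every $n\in\mathbb N$. In particular, for every $y\in B_X$ and every relatively $w^*$-open subset $W$ of $B_{X^{**}}$ containing $y$ there exists $u\in W$ satisfying (1) and (2).
   Context: All Banach spaces are real. $B_X$ and $S_X$ denote the closed unit ball and the unit sphere of $X$. $X$ and $Y$ are regarded as subspaces of $X^{**}$ and $Y^{**}$ via the canonical embeddings, and $T^{**}:X^{**}\to Y^{**}$ is the biadjoint of $T$. A slice of $B_X$ is a set of the form $S(B_X,x^*,\alpha)=\{x\in B_X: x^*(x)>\sup x^*(B_X)-\alpha\}$ with $x^*\in X^*$ and $\alpha>0$. A bounded linear operator $T:X\to Y$ is narrow if for all $x,y\in S_X$, every $\varepsilon>0$ and every slice $S$ of $B_X$ containing $y$ there exists $z\in S$ such that $\|x+z\|>2-\varepsilon$ and $\|T(y-z)\|<\varepsilon$. *)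

theory Defs
  imports "HOL-Analysis.Analysis"
begin

lift_definition canonical_embedding ::
    "'a::real_normed_vector \<Rightarrow> (('a \<Rightarrow>\<^sub>L real) \<Rightarrow>\<^sub>L real)"
  is "\<lambda>x f. blinfun_apply f x"
  by (rule blinfun.bounded_linear_left)

lift_definition adjoint_blinfun ::
    "('a::real_normed_vector \<Rightarrow>\<^sub>L 'b::real_normed_vector) \<Rightarrow>
      (('b \<Rightarrow>\<^sub>L real) \<Rightarrow>\<^sub>L ('a \<Rightarrow>\<^sub>L real))"
  is "\<lambda>T g. g o\<^sub>L T"
  by (rule bounded_bilinear.bounded_linear_left[OF bounded_bilinear_blinfun_compose])

definition biadjoint ::
    "('a::real_normed_vector \<Rightarrow>\<^sub>L 'b::real_normed_vector) \<Rightarrow>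
      ((('a \<Rightarrow>\<^sub>L real) \<Rightarrow>\<^sub>L real) \<Rightarrow>\<^sub>L (('b \<Rightarrow>\<^sub>L real) \<Rightarrow>\<^sub>L real))"
  where "biadjoint T = adjoint_blinfun (adjoint_blinfun T)"

definition slice :: "('a::real_normed_vector \<Rightarrow>\<^sub>L real) \<Rightarrow> real \<Rightarrow> 'a set"
  where "slice f \<alpha> =
    {x \<in> cball 0 1. blinfun_apply f x > (SUP z\<in>cball 0 1. blinfun_apply f z) - \<alpha>}"

definition narrow :: "('a::real_normed_vector \<Rightarrow>\<^sub>L 'b::real_normed_vector) \<Rightarrow> bool"
  where "narrow T \<longleftrightarrow>
    (\<forall>x\<in>sphere 0 1. \<forall>y\<in>sphere 0 1. \<forall>\<epsilon>>0. \<forall>f. \<forall>\<alpha>>0. y \<in> slice f \<alpha> \<longrightarrow>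
      (\<exists>z\<in>slice f \<alpha>. norm (x + z) > 2 - \<epsilon> \<and> norm (blinfun_apply T (y - z)) < \<epsilon>))"

(* The strong operator topology on bounded operators into the scalar field is
   the topology of pointwise convergence on functionals, that is, the weak* topology. *)
abbreviation weak_star_topology :: "('a::real_normed_vector \<Rightarrow>\<^sub>L real) topology"
  where "weak_star_topology \<equiv> strong_operator_topology"

end

theory Submission
  imports Defs
begin

text \<open>Narrowness says that near \<open>y\<close>, as measured by \<open>T\<close> and a one-sided estimate for one functional,
  there are points \<open>z\<close> of the unit ball for which the norm of \<open>x + z\<close> is almost maximal. The set of
  such \<open>z\<close> may be replaced by convex combinations, so a Krein--Milman argument upgrades this to
  two-sided estimates for finitely many functionals, and norming functionals then allow finitely many
  vectors \<open>x\<close> to be treated simultaneously. Applying this along a dense sequence \<open>d\<close> yields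
  \<open>z\<^sub>0, z\<^sub>1, \<dots>\<close> with \<open>T z\<^sub>n \<rightarrow> T y\<close>, \<open>g\<^sub>i z\<^sub>n \<rightarrow> g\<^sub>i y\<close> and
  \<open>d\<^sub>j + z\<^sub>N + \<dots> + z\<^sub>m\<close> of almost maximal norm for \<open>j \<le> N \<le> m\<close>. Then \<open>u\<close> is any weak* cluster point
  of this sequence: a weak* cluster point of norming functionals for these sums almost norms \<open>d\<^sub>j\<close> and
  is almost \<open>1\<close> on all \<open>z\<^sub>k\<close> with \<open>k \<ge> N\<close>, hence on \<open>u\<close>.\<close>

subsection \<open>Linear functionals\<close>

text \<open>Homogeneity is only an inequality because that form passes to infima of such
  functionals; equality follows by scaling back with \<open>1/c\<close>.\<close>

definition sublinear :: "('a::real_vector \<Rightarrow> real) \<Rightarrow> bool"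
  where "sublinear q \<longleftrightarrow>
    (\<forall>x y. q (x + y) \<le> q x + q y) \<and> (\<forall>c\<ge>0. \<forall>x. q (c *\<^sub>R x) \<le> c * q x)"

lemma sublinearD:
  assumes "sublinear q"
  shows sublinear_add: "q (x + y) \<le> q x + q y"
    and sublinear_scaleR: "c \<ge> 0 \<Longrightarrow> q (c *\<^sub>R x) = c * q x"
    and sublinear_zero: "q 0 = 0"
    and sublinear_minus: "- q (- x) \<le> q x"
proof -
  show add: "q (x + y) \<le> q x + q y" for x y
    using assms by (simp add: sublinear_def)
  have le: "q (c *\<^sub>R x) \<le> c * q x" if "c \<ge> 0" for c x
    using assms that by (simp add: sublinear_def)
  show zero: "q 0 = 0"
    using add[of 0 0] le[of 0 0] by simp
  show "- q (- x) \<le> q x"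
    using add[of x "- x"] zero by simp
  show "q (c *\<^sub>R x) = c * q x" if "c \<ge> 0"
  proof (cases "c = 0")
    case False
    with that have "q x \<le> (1/c) * q (c *\<^sub>R x)"
      using le[of "1/c" "c *\<^sub>R x"] by simp
    then show ?thesis
      using le[OF that, of x] that False by (simp add: field_simps)
  qed (simp add: zero)
qed

lemma sublinear_norm: "sublinear (norm :: 'a::real_normed_vector \<Rightarrow> real)"
  by (simp add: sublinear_def norm_triangle_ineq)

text \<open>Hahn--Banach: a minimal sublinear functional equals all its tilts below, hence is linear.\<close>

lemma sublinear_tilt:
  fixes q :: "'a::real_vector \<Rightarrow> real"
  assumes q: "sublinear q"
  defines "r \<equiv> \<lambda>a x. INF t\<in>{0..}. q (x + t *\<^sub>R a) - t * q a"
  shows "sublinear (r a)" and "t \<ge> 0 \<Longrightarrow> r a x \<le> q (x + t *\<^sub>R a) - t * q a"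
proof -
  have bdd: "bdd_below ((\<lambda>t. q (x + t *\<^sub>R a) - t * q a) ` {0..})" for x
  proof (rule bdd_belowI2)
    fix t :: real assume "t \<in> {0..}"
    then have "t * q a \<le> q (x + t *\<^sub>R a) + q (- x)"
      using sublinear_add[OF q, of "x + t *\<^sub>R a" "- x"] sublinear_scaleR[OF q, of t a] by simp
    then show "- q (- x) \<le> q (x + t *\<^sub>R a) - t * q a" by simp
  qed
  show le: "r a x \<le> q (x + t *\<^sub>R a) - t * q a" if "t \<ge> 0" for x t
    unfolding r_def using that by (intro cINF_lower bdd) auto
  have ge: "b \<le> r a x" if "\<And>t. t \<ge> 0 \<Longrightarrow> b \<le> q (x + t *\<^sub>R a) - t * q a" for b x
    unfolding r_def using that by (intro cINF_greatest) auto
  have "r a (x + y) \<le> r a x + r a y" for x y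
  proof -
    \<comment> \<open>\<open>t\<close> and \<open>s\<close> vary independently while
      \<open>t + s\<close> is admissible on the left, so the two infima can be taken one after the
      other.\<close>
    have "r a (x + y) - (q (x + t *\<^sub>R a) - t * q a) \<le> q (y + s *\<^sub>R a) - s * q a"
      if "t \<ge> 0" "s \<ge> 0" for s t
      using le[of "t + s" "x + y"] that
        sublinear_add[OF q, of "x + t *\<^sub>R a" "y + s *\<^sub>R a"]
      by (simp add: algebra_simps)
    then have "r a (x + y) - (q (x + t *\<^sub>R a) - t * q a) \<le> r a y" if "t \<ge> 0" for t
      using that by (intro ge) auto
    then have "r a (x + y) - r a y \<le> r a x"
      by (intro ge) (simp add: algebra_simps)
    then show ?thesis by simp
  qed
  moreover have "r a (c *\<^sub>R x) \<le> c * r a x" if c: "c \<ge> 0" for c x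
  proof (cases "c = 0")
    case True
    then show ?thesis using le[of 0 0] sublinear_zero[OF q] by simp
  next
    case False
    have "r a (c *\<^sub>R x) / c \<le> q (x + t *\<^sub>R a) - t * q a" if "t \<ge> 0" for t
      using le[of "c * t" "c *\<^sub>R x"] that c False
        sublinear_scaleR[OF q c, of "x + t *\<^sub>R a"]
      by (simp add: field_simps scaleR_add_right)
    then have "r a (c *\<^sub>R x) / c \<le> r a x"
      by (rule ge)
    then show ?thesis using c False by (simp add: field_simps)
  qed
  ultimately show "sublinear (r a)"
    by (simp add: sublinear_def)
qed

lemma Hahn_Banach_sublinear:
  fixes p :: "'a::real_vector \<Rightarrow> real"
  assumes p: "sublinear p"
  obtains f where "linear f" and "\<And>x. f x \<le> p x"
proof -
  define S where "S = {q. sublinear q \<and> q \<le> p}"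
  \<comment> \<open>Zorn's lemma for the reversed order: a maximal element there is a minimal
    functional.\<close>
  have "\<exists>m\<in>S. \<forall>q\<in>S. q \<le> m \<longrightarrow> q = m"
  proof (rule predicate_Zorn)
    show "partial_order_on S (relation_of (\<lambda>x y. y \<le> x) S)"
      by (rule partial_order_on_relation_ofI) auto
  next
    fix C assume "C \<in> Chains (relation_of (\<lambda>x y. y \<le> x) S)"
    then have CS: "C \<subseteq> S" and ch: "\<And>q r. q \<in> C \<Longrightarrow> r \<in> C \<Longrightarrow> q \<le> r \<or> r \<le> q"
      by (auto simp: Chains_def relation_of_def)
    show "\<exists>u\<in>S. \<forall>q\<in>C. u \<le> q"
    proof (cases "C = {}")
      case True
      then show ?thesis using p by (auto simp: S_def)
    next
      case False
      \<comment> \<open>A chain has its pointwise infimum as lower bound; it is finite since each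
        member is at least \<open>- p (- x)\<close> at \<open>x\<close>.\<close>
      define u where "u x = (INF q\<in>C. q x)" for x
      have bdd: "bdd_below ((\<lambda>q. q x) ` C)" for x
      proof (rule bdd_belowI2)
        fix q assume "q \<in> C"
        then have "sublinear q" "q (- x) \<le> p (- x)"
          using CS by (auto simp: S_def le_fun_def)
        then show "- p (- x) \<le> q x"
          using sublinear_minus[of q x] by simp
      qed
      have le: "u x \<le> q x" if "q \<in> C" for q x
        unfolding u_def using that by (intro cINF_lower bdd)
      have ge: "b \<le> u x" if "\<And>q. q \<in> C \<Longrightarrow> b \<le> q x" for b x
        unfolding u_def using that False by (intro cINF_greatest) auto
      have "u (x + y) \<le> u x + u y" for x y
      proof -
        \<comment> \<open>This is where the chain condition enters: the smaller of \<open>q\<close>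
          and \<open>r\<close> lies below both.\<close>
        have "u (x + y) - q x \<le> r y" if qr: "q \<in> C" "r \<in> C" for q r
        proof -
          obtain s where s: "s \<in> C" "s \<le> q" "s \<le> r"
            using ch[OF qr] qr by blast
          have "u (x + y) \<le> s (x + y)" using s by (intro le)
          also have "\<dots> \<le> s x + s y"
            using s CS by (intro sublinear_add) (auto simp: S_def)
          also have "\<dots> \<le> q x + r y"
            using s by (intro add_mono) (auto simp: le_fun_def)
          finally show ?thesis by simp
        qed
        then have "u (x + y) - q x \<le> u y" if "q \<in> C" for q
          using that by (intro ge) auto
        then have "u (x + y) - u y \<le> u x"
          by (intro ge) (simp add: algebra_simps)
        then show ?thesis by simp
      qed
      moreover have "u (c *\<^sub>R x) \<le> c * u x" if c: "c \<ge> 0" for c x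
      proof -
        have scale: "q (c *\<^sub>R x) = c * q x" if "q \<in> C" for q
          using that c CS by (intro sublinear_scaleR) (auto simp: S_def)
        show ?thesis
        proof (cases "c = 0")
          case True
          obtain q where "q \<in> C" using False by blast
          then show ?thesis
            using True scale[of q] le[of q "c *\<^sub>R x"] by simp
        next
          case c0: False
          have "u (c *\<^sub>R x) / c \<le> q x" if "q \<in> C" for q
            using le[OF that, of "c *\<^sub>R x"] scale[OF that] c c0 by (simp add: field_simps)
          then have "u (c *\<^sub>R x) / c \<le> u x" by (rule ge)
          then show ?thesis using c c0 by (simp add: field_simps)
        qed
      qed
      moreover have "u \<le> p"
      proof -
        obtain q where "q \<in> C" using False by blast
        then have "u \<le> q" "q \<le> p"
          using le CS by (auto simp: S_def le_fun_def)
        then show ?thesis by (rule order_trans)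
      qed
      ultimately have "u \<in> S" by (simp add: S_def sublinear_def)
      then show ?thesis using le by (auto simp: le_fun_def)
    qed
  qed
  then obtain m where m: "sublinear m" "m \<le> p"
    and minimal: "\<And>q. sublinear q \<Longrightarrow> q \<le> m \<Longrightarrow> q = m"
    unfolding S_def by (metis (mono_tags, lifting) mem_Collect_eq order_trans)
  \<comment> \<open>The tilt of \<open>m\<close> along \<open>a\<close> is sublinear and below
    \<open>m\<close>, so by minimality it is \<open>m\<close>; its bound at \<open>t = 1\<close> is
    the claim.\<close>
  have superadd: "m x + m a \<le> m (x + a)" for x a
  proof -
    define r where "r = (\<lambda>x. INF t\<in>{0..}. m (x + t *\<^sub>R a) - t * m a)"
    have "r \<le> m"
      using sublinear_tilt(2)[OF m(1), of 0] by (simp add: le_fun_def r_def)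
    then have "r = m"
      using sublinear_tilt(1)[OF m(1)] by (intro minimal) (auto simp: r_def)
    moreover have "r x \<le> m (x + 1 *\<^sub>R a) - 1 * m a"
      unfolding r_def by (rule sublinear_tilt(2)[OF m(1)]) simp
    ultimately show ?thesis by simp
  qed
  have add: "m (x + y) = m x + m y" for x y
    using superadd sublinear_add[OF m(1)] by (intro antisym)
  have neg: "m (- x) = - m x" for x
    using add[of x "- x"] sublinear_zero[OF m(1)] by simp
  have "linear m"
  proof (rule linearI)
    show "m (c *\<^sub>R x) = c *\<^sub>R m x" for c x
    proof (cases "c \<ge> 0")
      case False
      then have "m (- ((- c) *\<^sub>R x)) = c * m x"
        using sublinear_scaleR[OF m(1), of "- c" x] by (simp only: neg)
      then show ?thesis by simp
    qed (simp add: sublinear_scaleR[OF m(1)])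
  qed (rule add)
  then show ?thesis
    using that m(2) by (auto simp: le_fun_def)
qed

text \<open>Hahn-Banach is applied to the tilt of the norm along \<open>v\<close>, not to the norm
  itself: \<open>t = 0\<close> gives \<open>f x \<le> norm x\<close>, and \<open>t = 1\<close> at
  \<open>- v\<close> gives \<open>f (- v) \<le> - norm v\<close>.\<close>

lemma exists_norming_functional:
  fixes v :: "'a::real_normed_vector"
  obtains h :: "'a \<Rightarrow>\<^sub>L real" where "norm h \<le> 1" and "h v = norm v"
proof -
  define r where "r x = (INF t\<in>{0..}. norm (x + t *\<^sub>R v) - t * norm v)" for x
  have "sublinear r" and r: "\<And>t x. t \<ge> 0 \<Longrightarrow> r x \<le> norm (x + t *\<^sub>R v) - t * norm v"
    unfolding r_def using sublinear_tilt[OF sublinear_norm] by auto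
  then obtain f where f: "linear f" "\<And>x. f x \<le> r x"
    using Hahn_Banach_sublinear by blast
  have le: "f x \<le> norm x" for x
    using f(2)[of x] r[of 0 x] by simp
  have "\<bar>f x\<bar> \<le> norm x" for x
    using le[of x] le[of "- x"] linear_neg[OF f(1)] by (simp add: abs_le_iff)
  then have bl: "bounded_linear f" and abs: "\<And>x. \<bar>f x\<bar> \<le> 1 * norm x"
    using f(1) by (auto intro!: bounded_linear_intro[of f 1] simp: linear_add linear_cmul)
  have "f v \<ge> norm v"
    using f(2)[of "- v"] r[of 1 "- v"] linear_neg[OF f(1)] by simp
  then have "f v = norm v" using le[of v] by simp
  then show ?thesis
    using that[of "Blinfun f"] abs bl
    by (simp add: bounded_linear_Blinfun_apply norm_blinfun_bound)
qed

lemma blinfun_unit_le: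
  fixes h :: "'a::real_normed_vector \<Rightarrow>\<^sub>L real"
  assumes "norm h \<le> 1"
  shows "h x \<le> norm x"
  using norm_blinfun[of h x] mult_right_mono[OF assms norm_ge_zero[of x]] by simp

text \<open>The sequential consequence of Banach--Alaoglu that needs no separability: a cluster point, not a
  convergent subsequence.\<close>

lemma weak_star_cluster_point:
  fixes \<phi> :: "nat \<Rightarrow> ('v::real_normed_vector \<Rightarrow>\<^sub>L real)"
  assumes bound: "\<And>n. norm (\<phi> n) \<le> 1"
  obtains u :: "'v \<Rightarrow>\<^sub>L real" where "norm u \<le> 1"
    and "\<And>v C. closed C \<Longrightarrow> (\<forall>\<^sub>F n in sequentially. \<phi> n v \<in> C) \<Longrightarrow> u v \<in> C"
proof -
  \<comment> \<open>The norm bound places all \<open>\<phi> n\<close> in a product of intervals,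
    compact by Tychonoff.\<close>
  define K :: "('v \<Rightarrow> real) set" where "K = (\<Pi>\<^sub>E v\<in>UNIV. {- norm v..norm v})"
  define F where "F = filtermap (\<lambda>n. blinfun_apply (\<phi> n)) sequentially"
  have "compact K"
    unfolding K_def using compactin_PiE[of "\<lambda>_. euclidean" UNIV "\<lambda>v::'v. {- norm v..norm v}"]
    by (simp add: euclidean_product_topology)
  moreover have "F \<noteq> bot"
    by (simp add: F_def filtermap_bot_iff)
  moreover have "- norm v \<le> \<phi> n v \<and> \<phi> n v \<le> norm v" for n v
    using blinfun_unit_le[OF bound, of n v] blinfun_unit_le[OF bound, of n "- v"]
    by (simp add: blinfun.minus_right)
  then have "blinfun_apply (\<phi> n) \<in> K" for n
    by (simp add: K_def PiE_iff)
  then have "\<forall>\<^sub>F \<psi> in F. \<psi> \<in> K"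
    by (simp add: F_def eventually_filtermap)
  ultimately obtain g where g: "g \<in> K" "inf (nhds g) F \<noteq> bot"
    unfolding compact_filter by blast
  have cluster: "g \<in> C" if "closed C" "\<forall>\<^sub>F n in sequentially. blinfun_apply (\<phi> n) \<in> C" for C
  proof (rule ccontr)
    assume "g \<notin> C"
    then have "\<forall>\<^sub>F \<psi> in nhds g. \<psi> \<notin> C"
      using \<open>closed C\<close> by (auto simp: eventually_nhds intro!: exI[of _ "- C"])
    moreover have "\<forall>\<^sub>F \<psi> in F. \<psi> \<in> C"
      using that by (simp add: F_def eventually_filtermap)
    ultimately have "\<forall>\<^sub>F \<psi> in inf (nhds g) F. False"
      unfolding eventually_inf by blast
    then show False using g by (simp add: trivial_limit_def)
  qed
  have cont: "continuous_on UNIV (\<lambda>\<psi>::'v \<Rightarrow> real. \<psi> v)" for v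
    by (rule continuous_on_product_coordinates)
  \<comment> \<open>Each linearity equation is a closed condition that holds along the whole
    sequence, so it passes to \<open>g\<close>.\<close>
  have add: "g (v + w) = g v + g w" for v w
  proof -
    have "closed {\<psi>::'v \<Rightarrow> real. \<psi> (v + w) = \<psi> v + \<psi> w}"
      by (intro closed_Collect_eq continuous_intros cont)
    from cluster[OF this] show ?thesis by (simp add: blinfun.add_right)
  qed
  have scale: "g (c *\<^sub>R v) = c *\<^sub>R g v" for c v
  proof -
    have "closed {\<psi>::'v \<Rightarrow> real. \<psi> (c *\<^sub>R v) = c *\<^sub>R \<psi> v}"
      by (intro closed_Collect_eq continuous_intros cont)
    from cluster[OF this] show ?thesis by (simp add: blinfun.scaleR_right)
  qed
  have abs: "\<bar>g v\<bar> \<le> 1 * norm v" for v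
    using g(1) by (simp add: K_def PiE_iff abs_le_iff) (smt (verit))
  have bl: "bounded_linear g"
    using add scale abs by (intro bounded_linear_intro[of g 1]) auto
  show ?thesis
  proof (rule that[of "Blinfun g"])
    show "norm (Blinfun g) \<le> 1"
      using abs bl by (intro norm_blinfun_bound) (auto simp: bounded_linear_Blinfun_apply)
    fix v and C :: "real set"
    assume "closed C" and ev: "\<forall>\<^sub>F n in sequentially. \<phi> n v \<in> C"
    then have "closed ((\<lambda>\<psi>::'v \<Rightarrow> real. \<psi> v) -` C)"
      using closed_vimage[OF _ cont] by auto
    from cluster[OF this] ev show "Blinfun g v \<in> C"
      by (simp add: bl bounded_linear_Blinfun_apply)
  qed
qed

subsection \<open>Narrow seminorms\<close>

text \<open>All \<open>x\<close> are allowed, not only unit vectors, so that the condition can be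
  applied again at a shifted point \<open>x + s *\<^sub>R a\<close>.\<close>

definition octahedral_set :: "'a::real_normed_vector set \<Rightarrow> bool"
  where "octahedral_set A \<longleftrightarrow>
    (\<forall>x. \<forall>\<epsilon>>0. \<exists>z\<in>A. norm z \<le> 1 \<and> norm (x + z) > norm x + 1 - \<epsilon>)"

lemma octahedral_setD:
  assumes "octahedral_set A" "\<epsilon> > 0"
  obtains z where "z \<in> A" "norm z \<le> 1" "norm (x + z) > norm x + 1 - \<epsilon>"
  using assms unfolding octahedral_set_def by blast

lemma octahedral_set_mono: "octahedral_set A \<Longrightarrow> A \<subseteq> B \<Longrightarrow> octahedral_set B"
  unfolding octahedral_set_def by blast

text \<open>Shrinking \<open>a\<close> to \<open>s *\<^sub>R a\<close> moves the sum by at most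
  \<open>1 - s\<close>, so \<open>s\<close> of the gain \<open>1\<close> survives, with the same
  error.\<close>

lemma norm_add_shrink:
  fixes x a :: "'a::real_normed_vector"
  assumes "norm a \<le> 1" "0 \<le> s" "s \<le> 1" "norm (x + a) > norm x + 1 - \<epsilon>"
  shows "norm (x + s *\<^sub>R a) > norm x + s - \<epsilon>"
proof -
  have "norm (x + a) \<le> norm (x + s *\<^sub>R a) + norm ((1 - s) *\<^sub>R a)"
    by (rule order_trans[OF _ norm_triangle_ineq]) (simp add: algebra_simps)
  moreover have "norm ((1 - s) *\<^sub>R a) \<le> 1 - s"
    using assms by (simp add: mult_left_le)
  ultimately show ?thesis using assms(4) by linarith
qed

text \<open>First \<open>a\<close> is chosen for \<open>x\<close>, then \<open>b\<close> for
  \<open>x + s *\<^sub>R a\<close>; the shrunken gains \<open>s\<close> and \<open>t\<close> add up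
  to \<open>1\<close>.\<close>

lemma octahedral_set_convex_comb:
  assumes A: "octahedral_set A" and B: "octahedral_set B" and st: "0 \<le> s" "0 \<le> t" "s + t = 1"
  shows "octahedral_set {s *\<^sub>R a + t *\<^sub>R b |a b. a \<in> A \<and> b \<in> B \<and> norm a \<le> 1 \<and> norm b \<le> 1}"
  unfolding octahedral_set_def
proof (intro allI impI)
  fix x :: 'a and \<epsilon> :: real
  assume "\<epsilon> > 0"
  then have e2: "\<epsilon>/2 > 0" by simp
  obtain a where a: "a \<in> A" "norm a \<le> 1" "norm (x + a) > norm x + 1 - \<epsilon>/2"
    using octahedral_setD[OF A e2] .
  obtain b where b: "b \<in> B" "norm b \<le> 1"
    "norm ((x + s *\<^sub>R a) + b) > norm (x + s *\<^sub>R a) + 1 - \<epsilon>/2"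
    using octahedral_setD[OF B e2] .
  have "norm (x + s *\<^sub>R a) > norm x + s - \<epsilon>/2"
    using a st by (intro norm_add_shrink) auto
  moreover have "norm ((x + s *\<^sub>R a) + t *\<^sub>R b) > norm (x + s *\<^sub>R a) + t - \<epsilon>/2"
    using b st by (intro norm_add_shrink) auto
  ultimately have "norm (x + (s *\<^sub>R a + t *\<^sub>R b)) > norm x + 1 - \<epsilon>"
    using st by (simp add: add.assoc)
  moreover have "norm (s *\<^sub>R a + t *\<^sub>R b) \<le> 1"
    using convex_cball[of "0::'a" 1, unfolded convex_def] a b st by simp
  ultimately show "\<exists>z\<in>{s *\<^sub>R a + t *\<^sub>R b |a b. a \<in> A \<and> b \<in> B \<and> norm a \<le> 1 \<and> norm b \<le> 1}.
      norm z \<le> 1 \<and> norm (x + z) > norm x + 1 - \<epsilon>"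
    using a b by blast
qed

section \<open>Seminorms and the seminorm form of narrowness\<close>

definition seminorm :: "('a::real_vector \<Rightarrow> real) \<Rightarrow> bool"
  where "seminorm p \<longleftrightarrow> (\<forall>x y. p (x + y) \<le> p x + p y) \<and> (\<forall>c x. p (c *\<^sub>R x) = \<bar>c\<bar> * p x)"

lemma seminorm_add: "seminorm p \<Longrightarrow> p (x + y) \<le> p x + p y"
  and seminorm_scaleR: "seminorm p \<Longrightarrow> p (c *\<^sub>R x) = \<bar>c\<bar> * p x"
  by (simp_all add: seminorm_def)

lemma seminorm_zero: "seminorm p \<Longrightarrow> p 0 = 0"
  using seminorm_scaleR[of p 0 0] by simp

lemma seminorm_norm_blinfun: "seminorm (\<lambda>x. norm (blinfun_apply T x))"
  by (simp add: seminorm_def blinfun.add_right blinfun.scaleR_right norm_triangle_ineq)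

lemma seminorm_plus: "seminorm p \<Longrightarrow> seminorm q \<Longrightarrow> seminorm (\<lambda>x. p x + q x)"
  unfolding seminorm_def by (simp add: distrib_left) (metis add.assoc add.left_commute add_mono)

lemma seminorm_nonneg:
  assumes "seminorm p" shows "p x \<ge> 0"
  using seminorm_add[OF assms, of x "- x"] seminorm_scaleR[OF assms, of "-1" x] seminorm_zero[OF assms]
  by simp

lemma seminorm_convex_comb_less:
  assumes p: "seminorm p" and "0 \<le> s" "0 \<le> t" "s + t = 1" and ab: "p (y1 - a) < \<epsilon>" "p (y2 - b) < \<epsilon>"
  shows "p (s *\<^sub>R y1 + t *\<^sub>R y2 - (s *\<^sub>R a + t *\<^sub>R b)) < \<epsilon>"
proof -
  have "p (s *\<^sub>R y1 + t *\<^sub>R y2 - (s *\<^sub>R a + t *\<^sub>R b)) = p (s *\<^sub>R (y1 - a) + t *\<^sub>R (y2 - b))"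
    by (simp add: algebra_simps)
  also have "\<dots> \<le> s * p (y1 - a) + t * p (y2 - b)"
    using seminorm_add[OF p, of "s *\<^sub>R (y1 - a)" "t *\<^sub>R (y2 - b)"] assms(2,3)
    by (simp add: seminorm_scaleR[OF p])
  also have "\<dots> < \<epsilon>"
    using assms by (intro convex_bound_lt)
  finally show ?thesis .
qed

text \<open>A seminorm takes the place of the operator so that functionals can be absorbed into it
  one at a time; the slice becomes the one-sided estimate for \<open>f\<close>.\<close>

definition narrow_seminorm :: "('a::real_normed_vector \<Rightarrow> real) \<Rightarrow> bool"
  where "narrow_seminorm p \<longleftrightarrow> seminorm p \<and>
    (\<forall>y f \<epsilon>. norm y \<le> 1 \<longrightarrow> \<epsilon> > 0 \<longrightarrow>
      octahedral_set {z. norm z \<le> 1 \<and> p (y - z) < \<epsilon> \<and> blinfun_apply f z > f y - \<epsilon>})"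

text \<open>Narrowness speaks of unit \<open>x\<close>. A short \<open>x\<close> is compared with a
  unit vector on its ray; a long one is scaled to norm 1, and scaling back costs the term
  \<open>(r - 1) *\<^sub>R z\<close>.\<close>

lemma narrow_octahedral_set:
  fixes T :: "'a::real_normed_vector \<Rightarrow>\<^sub>L 'b::real_normed_vector"
  assumes narrow: "narrow T" and y: "norm y = 1" and e: "\<epsilon> > 0"
  shows "octahedral_set {z. norm z \<le> 1 \<and> norm (T (y - z)) < \<epsilon> \<and> blinfun_apply f z > f y - \<epsilon>}"
    (is "octahedral_set ?A")
proof -
  let ?M = "SUP z\<in>cball 0 1. blinfun_apply f z"
  have "f z \<le> norm f" if "z \<in> cball 0 1" for z
    using norm_blinfun[of f z] that mult_left_le[of "norm z" "norm f"] by simp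
  then have "bdd_above (blinfun_apply f ` cball 0 1)"
    by (intro bdd_aboveI2)
  then have "f y \<le> ?M"
    using y by (intro cSUP_upper) auto
  then have \<alpha>: "?M - f y + \<epsilon> > 0" using e by simp
  \<comment> \<open>This width puts the lower end of the slice at
    \<open>f y - \<epsilon>\<close>.\<close>
  have slice: "slice f (?M - f y + \<epsilon>) = {z. norm z \<le> 1 \<and> f z > f y - \<epsilon>}"
    by (auto simp: slice_def)
  have unit: "\<exists>z\<in>?A. norm (x + z) > 2 - \<delta>" if x: "norm x = 1" and \<delta>: "\<delta> > 0" for x \<delta>
  proof -
    have "y \<in> slice f (?M - f y + \<epsilon>)"
      using y e by (simp add: slice)
    moreover have "min \<delta> \<epsilon> > 0" using e \<delta> by simp
    ultimately obtain z where z: "z \<in> slice f (?M - f y + \<epsilon>)"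
      "norm (x + z) > 2 - min \<delta> \<epsilon>" "norm (T (y - z)) < min \<delta> \<epsilon>"
      using narrow[unfolded narrow_def, rule_format, of x y "min \<delta> \<epsilon>" "?M - f y + \<epsilon>" f] \<alpha> x y
      by auto
    then show ?thesis
      unfolding slice by (intro bexI[of _ z]) auto
  qed
  show ?thesis
    unfolding octahedral_set_def
  proof (intro allI impI)
    fix x :: 'a and \<delta> :: real
    assume \<delta>: "\<delta> > 0"
    show "\<exists>z\<in>?A. norm z \<le> 1 \<and> norm (x + z) > norm x + 1 - \<delta>"
    proof (cases "norm x \<le> 1")
      case True
      \<comment> \<open>For \<open>x = 0\<close> every unit vector is at the right distance, and
        \<open>y\<close> is one.\<close>
      define e where "e = (if x = 0 then y else x /\<^sub>R norm x)"
      have e: "norm e = 1" "norm (e - x) = 1 - norm x"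
      proof -
        show "norm e = 1" using y by (simp add: e_def)
        have "norm (e - x) = norm ((1 / norm x - 1) *\<^sub>R x)" if "x \<noteq> 0"
          using that by (simp add: e_def algebra_simps divide_inverse)
        also have "\<dots> = 1 - norm x" if "x \<noteq> 0"
          using that True by (simp add: field_simps)
        finally show "norm (e - x) = 1 - norm x"
          using y by (cases "x = 0") (auto simp: e_def)
      qed
      obtain z where z: "z \<in> ?A" "norm (e + z) > 2 - \<delta>"
        using unit[OF e(1) \<delta>] by blast
      have "norm (e + z) \<le> norm (x + z) + norm (e - x)"
        by (rule order_trans[OF _ norm_triangle_ineq]) (simp add: algebra_simps)
      then show ?thesis using z e by auto
    next
      case False
      define r where "r = norm x"
      have r: "r > 1" using False by (simp add: r_def)
      have "norm (x /\<^sub>R r) = 1"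
        using False by (cases "x = 0") (auto simp: r_def)
      \<comment> \<open>Multiplication by \<open>r\<close> will turn this tolerance into
        \<open>\<delta>\<close>.\<close>
      moreover have "\<delta> / r > 0" using r \<delta> by simp
      ultimately obtain z where z: "z \<in> ?A" "norm (x /\<^sub>R r + z) > 2 - \<delta> / r"
        using unit by blast
      have "r * norm (x /\<^sub>R r + z) = norm (r *\<^sub>R (x /\<^sub>R r + z))"
        using r by simp
      also have "r *\<^sub>R (x /\<^sub>R r + z) = (x + z) + (r - 1) *\<^sub>R z"
        using r by (simp add: algebra_simps)
      also have "norm \<dots> \<le> norm (x + z) + norm ((r - 1) *\<^sub>R z)"
        by (rule norm_triangle_ineq)
      also have "norm ((r - 1) *\<^sub>R z) \<le> r - 1"
        using z r by (simp add: mult_left_le)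
      finally have "r * norm (x /\<^sub>R r + z) \<le> norm (x + z) + (r - 1)" by simp
      moreover have "r * norm (x /\<^sub>R r + z) > r * (2 - \<delta> / r)"
        using z r by simp
      moreover have "r * (2 - \<delta> / r) = 2 * r - \<delta>"
        using r by (simp add: field_simps)
      ultimately have "norm (x + z) > norm x + 1 - \<delta>"
        by (simp add: r_def)
      then show ?thesis using z by auto
    qed
  qed
qed

text \<open>A point of the ball lies on a segment between antipodal unit vectors, where narrowness
  applies; the octahedral sets at both ends are averaged. Non-triviality of the space supplies the
  ends for \<open>y = 0\<close>.\<close>

lemma narrow_imp_narrow_seminorm:
  fixes T :: "'a::real_normed_vector \<Rightarrow>\<^sub>L 'b::real_normed_vector"
  assumes narrow: "narrow T" and nonzero: "\<exists>x::'a. x \<noteq> 0"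
  shows "narrow_seminorm (\<lambda>x. norm (T x))"
  unfolding narrow_seminorm_def
proof (intro conjI allI impI seminorm_norm_blinfun)
  fix y :: 'a and f :: "'a \<Rightarrow>\<^sub>L real" and \<epsilon> :: real
  assume y: "norm y \<le> 1" and e: "\<epsilon> > 0"
  let ?A = "\<lambda>y. {z. norm z \<le> 1 \<and> norm (T (y - z)) < \<epsilon> \<and> f z > f y - \<epsilon>}"
  obtain v where v: "norm v = 1" "y = norm y *\<^sub>R v"
  proof (cases "y = 0")
    case True
    obtain x :: 'a where "x \<noteq> 0" using nonzero by blast
    then show ?thesis using True that[of "x /\<^sub>R norm x"] by simp
  next
    case False
    then show ?thesis using that[of "y /\<^sub>R norm y"] by simp
  qed
  \<comment> \<open>The solution of \<open>s + t = 1\<close> and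
    \<open>s - t = norm y\<close>.\<close>
  define s where "s = (1 + norm y) / 2"
  define t where "t = (1 - norm y) / 2"
  have st: "0 \<le> s" "0 \<le> t" "s + t = 1" using y by (auto simp: s_def t_def field_simps)
  have y_eq: "s *\<^sub>R v + t *\<^sub>R (- v) = y"
  proof -
    have "s *\<^sub>R v + t *\<^sub>R (- v) = (s - t) *\<^sub>R v" by (simp add: algebra_simps)
    also have "s - t = norm y" by (simp add: s_def t_def field_simps)
    finally show ?thesis using v by simp
  qed
  have "octahedral_set (?A v)" "octahedral_set (?A (- v))"
    using v(1) e by (auto intro!: narrow_octahedral_set[OF narrow])
  from octahedral_set_convex_comb[OF this st]
  show "octahedral_set (?A y)"
  proof (rule octahedral_set_mono, safe)
    fix a b
    assume a: "norm a \<le> 1" "norm (T (v - a)) < \<epsilon>" "f a > f v - \<epsilon>"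
      and b: "norm b \<le> 1" "norm (T (- v - b)) < \<epsilon>" "f b > f (- v) - \<epsilon>"
    show "norm (s *\<^sub>R a + t *\<^sub>R b) \<le> 1"
      using convex_cball[of "0::'a" 1, unfolded convex_def] a b st by simp
    show "norm (T (y - (s *\<^sub>R a + t *\<^sub>R b))) < \<epsilon>"
      using seminorm_convex_comb_less[OF seminorm_norm_blinfun st a(2) b(2)] by (simp only: y_eq)
    have "s * (f v - f a) + t * (f (- v) - f b) < \<epsilon>"
      using a b st by (intro convex_bound_lt) auto
    moreover have "f y = s * f v + t * f (- v)"
      by (subst y_eq[symmetric]) (simp only: blinfun.add_right blinfun.scaleR_right real_scaleR_def)
    ultimately show "f (s *\<^sub>R a + t *\<^sub>R b) > f y - \<epsilon>"
      by (simp add: blinfun.add_right blinfun.scaleR_right algebra_simps)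
  qed
qed

text \<open>By extremality \<open>k\<close> is not in the convex hull of \<open>K - ball k \<delta>\<close>, which is compact and
  can therefore be separated from \<open>k\<close>.\<close>

lemma extreme_point_slice:
  fixes K :: "'a::euclidean_space set"
  assumes K: "compact K" "convex K" and k: "k extreme_point_of K" and \<delta>: "\<delta> > 0"
  obtains a b where "a \<bullet> k < b" and "\<And>m. m \<in> K \<Longrightarrow> a \<bullet> m < b \<Longrightarrow> dist m k < \<delta>"
proof -
  define M where "M = convex hull (K - ball k \<delta>)"
  have "k \<notin> M"
  proof
    assume "k \<in> M"
    have "M \<subseteq> K" unfolding M_def using K by (intro hull_minimal) auto
    then have "k extreme_point_of M"
      using k \<open>k \<in> M\<close> by (auto simp: extreme_point_of_def)
    \<comment> \<open>An extreme point of a convex hull belongs to the generating set.\<close>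
    then have "k \<in> K - ball k \<delta>" unfolding M_def by (rule extreme_point_of_convex_hull)
    then show False using \<delta> by simp
  qed
  moreover have "compact M"
    unfolding M_def using K by (intro compact_convex_hull compact_diff) auto
  ultimately obtain a b where ab: "a \<bullet> k < b" "\<forall>x\<in>M. a \<bullet> x > b"
    using separating_hyperplane_closed_point[of M k] compact_imp_closed
    unfolding M_def by (metis convex_convex_hull)
  show ?thesis
  proof (rule that[OF ab(1)])
    fix m assume "m \<in> K" "a \<bullet> m < b"
    then have "m \<notin> M" using ab(2) by force
    then show "dist m k < \<delta>"
      using \<open>m \<in> K\<close> hull_inc[of m "K - ball k \<delta>" convex] by (auto simp: M_def dist_commute)
  qed
qed

text \<open>A one-sided estimate for functionals becomes two-sided: map the set of admissible points to
  the plane by \<open>(f, g)\<close>. By Krein--Milman the image of \<open>y\<close> is a convex combination of extreme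
  points of the closed image, each of these has small slices, and good points in
  the slices may be averaged.\<close>

lemma narrow_seminorm_add_functional:
  fixes g :: "'a::real_normed_vector \<Rightarrow>\<^sub>L real"
  assumes p: "narrow_seminorm p"
  shows "narrow_seminorm (\<lambda>x. p x + \<bar>g x\<bar>)"
  unfolding narrow_seminorm_def
proof (intro conjI allI impI)
  have sp: "seminorm p" using p by (simp add: narrow_seminorm_def)
  then show "seminorm (\<lambda>x. p x + \<bar>g x\<bar>)"
    using seminorm_plus[OF _ seminorm_norm_blinfun[of g]] by simp
  fix y :: 'a and f :: "'a \<Rightarrow>\<^sub>L real" and \<epsilon> :: real
  assume y: "norm y \<le> 1" and e: "\<epsilon> > 0"
  define W where "W = {z. norm z \<le> 1 \<and> p (y - z) < \<epsilon>/2}"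
  define F where "F z = (f z, g z)" for z
  have F_lin: "F (s *\<^sub>R a + t *\<^sub>R b) = s *\<^sub>R F a + t *\<^sub>R F b" for s t a b
    by (simp add: F_def blinfun.add_right blinfun.scaleR_right)
  \<comment> \<open>Points of the plane approximated by \<open>F\<close> on octahedral parts of
    \<open>W\<close>. The goal is \<open>F y \<in> D\<close>.\<close>
  define D where "D = {k. \<forall>\<delta>>0. octahedral_set {z \<in> W. dist (F z) k < \<delta>}}"
  define K where "K = closure (F ` W)"
  have W_comb: "s *\<^sub>R a + t *\<^sub>R b \<in> W"
    if "a \<in> W" "b \<in> W" and st: "0 \<le> s" "0 \<le> t" "s + t = 1" for a b s t
  proof -
    have "s *\<^sub>R y + t *\<^sub>R y = y"
      using st by (simp flip: scaleR_add_left)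
    then have "p (y - (s *\<^sub>R a + t *\<^sub>R b)) < \<epsilon>/2"
      using seminorm_convex_comb_less[OF sp st, of y a "\<epsilon>/2" y b] that by (simp add: W_def)
    moreover have "norm (s *\<^sub>R a + t *\<^sub>R b) \<le> 1"
      using convex_cball[of "0::'a" 1, unfolded convex_def] that by (simp add: W_def)
    ultimately show ?thesis by (simp add: W_def)
  qed
  have "convex D"
  proof (rule convexI)
    fix k l and s t :: real
    assume kl: "k \<in> D" "l \<in> D" and st: "0 \<le> s" "0 \<le> t" "s + t = 1"
    have "octahedral_set {z \<in> W. dist (F z) (s *\<^sub>R k + t *\<^sub>R l) < \<delta>}" if "\<delta> > 0" for \<delta>
    proof -
      have "octahedral_set {z \<in> W. dist (F z) k < \<delta>}" "octahedral_set {z \<in> W. dist (F z) l < \<delta>}"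
        using kl that by (auto simp: D_def)
      from octahedral_set_convex_comb[OF this st] show ?thesis
      proof (rule octahedral_set_mono, safe)
        fix a b
        assume ab: "a \<in> W" "b \<in> W" "dist (F a) k < \<delta>" "dist (F b) l < \<delta>"
        show "s *\<^sub>R a + t *\<^sub>R b \<in> W" using ab st by (intro W_comb)
        show "dist (F (s *\<^sub>R a + t *\<^sub>R b)) (s *\<^sub>R k + t *\<^sub>R l) < \<delta>"
          using seminorm_convex_comb_less[of norm, OF _ st, of "F a" k \<delta> "F b" l] ab
          by (simp add: F_lin dist_norm seminorm_def norm_triangle_ineq)
      qed
    qed
    then show "s *\<^sub>R k + t *\<^sub>R l \<in> D" by (simp add: D_def)
  qed
  have "convex (F ` W)"
  proof (rule convexI)
    fix k l and s t :: real
    assume "k \<in> F ` W" "l \<in> F ` W" and st: "0 \<le> s" "0 \<le> t" "s + t = 1"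
    then obtain a b where "a \<in> W" "b \<in> W" "k = F a" "l = F b" by blast
    then show "s *\<^sub>R k + t *\<^sub>R l \<in> F ` W"
      using W_comb[of a b, OF _ _ st] by (simp flip: F_lin)
  qed
  then have "convex K" by (simp add: K_def convex_closure)
  have "norm (F z) \<le> norm f + norm g" if "z \<in> W" for z
  proof -
    have "\<bar>f z\<bar> \<le> norm f" "\<bar>g z\<bar> \<le> norm g"
      using norm_blinfun[of f z] norm_blinfun[of g z] that
        mult_left_le[of "norm z" "norm f"] mult_left_le[of "norm z" "norm g"]
      by (auto simp: W_def)
    then show ?thesis
      using norm_Pair_le[of "f z" "g z"] by (simp add: F_def)
  qed
  then have "bounded (F ` W)" by (auto simp: bounded_iff)
  then have "compact K" by (simp add: K_def)
  have extreme: "k \<in> D" if k: "k extreme_point_of K" for k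
    unfolding D_def mem_Collect_eq
  proof (intro allI impI)
    fix \<delta> :: real assume \<delta>: "\<delta> > 0"
    obtain a b where ab: "a \<bullet> k < b" "\<And>m. m \<in> K \<Longrightarrow> a \<bullet> m < b \<Longrightarrow> dist m k < \<delta>"
      using extreme_point_slice[OF \<open>compact K\<close> \<open>convex K\<close> k \<delta>] by blast
    \<comment> \<open>\<open>k\<close> may be only a limit of values of \<open>F\<close>, so the
      slice is entered through an actual value \<open>F w\<close>, and narrowness is used at
      \<open>w\<close>.\<close>
    have "k \<in> closure (F ` W)"
      using k by (simp add: extreme_point_of_def K_def)
    moreover have "open {m. a \<bullet> m < b}" by (rule open_halfspace_lt)
    ultimately obtain w where w: "w \<in> W" "a \<bullet> F w < b"
      using ab(1) by (auto simp: closure_iff_nhds_not_empty)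
    \<comment> \<open>The sign turns the slice \<open>a \<bullet> m < b\<close> into a lower
      estimate, the side that \<open>narrow_seminorm\<close> controls.\<close>
    define \<phi> where "\<phi> = - (fst a *\<^sub>R f + snd a *\<^sub>R g)"
    have \<phi>: "\<phi> z = - (a \<bullet> F z)" for z
      by (simp add: \<phi>_def F_def inner_prod_def blinfun.bilinear_simps)
    \<comment> \<open>The room left at \<open>w\<close> in both conditions: membership in
      \<open>W\<close> and in the half-plane.\<close>
    define \<eta> where "\<eta> = min (\<epsilon>/2 - p (y - w)) (b - a \<bullet> F w)"
    have "\<eta> > 0" using w by (simp add: \<eta>_def W_def)
    then have "octahedral_set {z. norm z \<le> 1 \<and> p (w - z) < \<eta> \<and> \<phi> z > \<phi> w - \<eta>}"
      using p w by (simp add: narrow_seminorm_def W_def)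
    then show "octahedral_set {z \<in> W. dist (F z) k < \<delta>}"
    proof (rule octahedral_set_mono, safe)
      fix z assume z: "norm z \<le> 1" "p (w - z) < \<eta>" "\<phi> z > \<phi> w - \<eta>"
      have "p (y - z) \<le> p (y - w) + p (w - z)"
        using seminorm_add[OF sp, of "y - w" "w - z"] by simp
      then show "z \<in> W" using z by (simp add: W_def \<eta>_def)
      then have "F z \<in> K" unfolding K_def by (intro subsetD[OF closure_subset] imageI)
      then show "dist (F z) k < \<delta>"
        using z by (intro ab) (auto simp: \<phi> \<eta>_def)
    qed
  qed
  \<comment> \<open>In finite dimension the hull needs no closure, so convexity of \<open>D\<close>
    suffices.\<close>
  have "K = convex hull {k. k extreme_point_of K}"
    using \<open>compact K\<close> \<open>convex K\<close> by (rule Krein_Milman_Minkowski)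
  also have "\<dots> \<subseteq> D"
    using extreme \<open>convex D\<close> by (intro hull_minimal) auto
  finally have "K \<subseteq> D" .
  moreover have "y \<in> W" using y e seminorm_zero[OF sp] by (simp add: W_def)
  then have "F y \<in> K" unfolding K_def by (intro subsetD[OF closure_subset] imageI)
  ultimately have "F y \<in> D" by blast
  then have "octahedral_set {z \<in> W. dist (F z) (F y) < \<epsilon>/2}"
    unfolding D_def mem_Collect_eq using e half_gt_zero by blast
  then show "octahedral_set {z. norm z \<le> 1 \<and> p (y - z) + \<bar>g (y - z)\<bar> < \<epsilon> \<and> f z > f y - \<epsilon>}"
  proof (rule octahedral_set_mono, safe)
    fix z assume z: "z \<in> W" "dist (F z) (F y) < \<epsilon>/2"
    show "norm z \<le> 1" using z by (simp add: W_def)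
    have "\<bar>f z - f y\<bar> < \<epsilon>/2" "\<bar>g z - g y\<bar> < \<epsilon>/2"
      using dist_fst_le[of "F z" "F y"] dist_snd_le[of "F z" "F y"] z(2)
      by (auto simp: F_def dist_real_def)
    moreover have "p (y - z) < \<epsilon>/2" using z by (simp add: W_def)
    ultimately show "p (y - z) + \<bar>g (y - z)\<bar> < \<epsilon>" "f z > f y - \<epsilon>"
      using e unfolding blinfun.diff_right by linarith+
  qed
qed

lemma narrow_seminorm_add_sum:
  fixes g :: "nat \<Rightarrow> ('a::real_normed_vector \<Rightarrow>\<^sub>L real)"
  assumes "narrow_seminorm p"
  shows "narrow_seminorm (\<lambda>x. p x + (\<Sum>i<n. \<bar>g i x\<bar>))"
proof (induction n)
  case 0
  then show ?case using assms by simp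
next
  case (Suc n)
  from narrow_seminorm_add_functional[OF this, of "g n"] show ?case
    by (simp add: add.assoc)
qed

text \<open>Once a norming functional \<open>h\<close> of \<open>v + w\<close> is kept under control by the seminorm,
  moving \<open>w\<close> to treat further vectors does not spoil the estimate at \<open>v\<close>.\<close>

lemma narrow_seminorm_finite:
  assumes "finite V" and "narrow_seminorm p" and "norm y \<le> 1" and "\<epsilon> > 0"
  shows "\<exists>z. norm z \<le> 1 \<and> p (y - z) < \<epsilon> \<and> (\<forall>v\<in>V. norm (v + z) > norm v + 1 - \<epsilon>)"
  using assms
proof (induction V arbitrary: p y \<epsilon> rule: finite_induct)
  case empty
  then have "p (y - y) < \<epsilon>"
    by (simp add: narrow_seminorm_def seminorm_zero)
  then show ?case using empty by blast
next
  case (insert v V)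
  have e2: "\<epsilon>/2 > 0" using insert.prems by simp
  have sp: "seminorm p" using insert.prems by (simp add: narrow_seminorm_def)
  \<comment> \<open>The zero functional makes the slice condition void.\<close>
  have "octahedral_set {z. norm z \<le> 1 \<and> p (y - z) < \<epsilon>/2 \<and> blinfun_apply 0 z > blinfun_apply 0 y - \<epsilon>/2}"
    using insert.prems e2 unfolding narrow_seminorm_def by blast
  from octahedral_setD[OF this e2, of v]
  obtain w where w: "norm w \<le> 1" "p (y - w) < \<epsilon>/2" "norm (v + w) > norm v + 1 - \<epsilon>/2"
    by blast
  obtain h :: "'a \<Rightarrow>\<^sub>L real" where h: "norm h \<le> 1" "h (v + w) = norm (v + w)"
    using exists_norming_functional .
  \<comment> \<open>The induction hypothesis is used around \<open>w\<close>, with \<open>h\<close>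
    added to the seminorm; the two tolerances \<open>\<epsilon>/2\<close> add up.\<close>
  obtain z where z: "norm z \<le> 1" "p (w - z) + \<bar>h (w - z)\<bar> < \<epsilon>/2"
    "\<forall>u\<in>V. norm (u + z) > norm u + 1 - \<epsilon>/2"
    using insert.IH[OF narrow_seminorm_add_functional[OF insert.prems(1), of h] w(1) e2] by blast
  have "p (w - z) \<ge> 0" by (rule seminorm_nonneg[OF sp])
  have "p (y - z) \<le> p (y - w) + p (w - z)"
    using seminorm_add[OF sp, of "y - w" "w - z"] by simp
  then have "p (y - z) < \<epsilon>" using w z by linarith
  moreover have "norm (v + z) > norm v + 1 - \<epsilon>"
  proof -
    have "h (v + w) - h (w - z) = h (v + z)"
      by (simp add: blinfun.bilinear_simps)
    also have "\<dots> \<le> norm (v + z)" by (rule blinfun_unit_le[OF h(1)])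
    finally show ?thesis using w h z \<open>p (w - z) \<ge> 0\<close> by linarith
  qed
  moreover have "norm (u + z) > norm u + 1 - \<epsilon>" if "u \<in> V" for u
    using z(3) that insert.prems by fastforce
  ultimately show ?case using z(1) by blast
qed

subsection \<open>Elements of the bidual\<close>

declare canonical_embedding.rep_eq [simp] adjoint_blinfun.rep_eq [simp]

lemma norm_canonical_embedding_le: "norm (canonical_embedding x) \<le> norm x"
proof (rule norm_blinfun_bound)
  show "norm (canonical_embedding x f) \<le> norm x * norm f" for f
    using norm_blinfun[of f x] by (simp add: mult.commute)
qed simp

text \<open>No term exceeds its own bound, \<open>norm v\<close> or \<open>1\<close>; if the total
  falls short of the sum of the bounds by at most \<open>\<delta>\<close>, so does each
  term.\<close>

lemma norming_functional_of_sum: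
  fixes h :: "'a::real_normed_vector \<Rightarrow>\<^sub>L real" and z :: "nat \<Rightarrow> 'a"
  assumes h: "norm h \<le> 1" and z: "\<And>k. k < i \<Longrightarrow> norm (z k) \<le> 1"
    and sum: "h (v + (\<Sum>k<i. z k)) \<ge> norm v + real i - \<delta>"
  shows "h v \<ge> norm v - \<delta>" and "k < i \<Longrightarrow> h (z k) \<ge> 1 - \<delta>"
proof -
  have hz: "h (z k) \<le> 1" if "k < i" for k
    using blinfun_unit_le[OF h, of "z k"] z[OF that] by simp
  have eq: "h (v + (\<Sum>k<i. z k)) = h v + (\<Sum>k<i. h (z k))"
    by (simp add: blinfun.add_right blinfun.sum_right)
  have "(\<Sum>k<i. h (z k)) \<le> (\<Sum>k<i. 1)"
    using hz by (intro sum_mono) auto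
  then show "h v \<ge> norm v - \<delta>"
    using sum eq by simp
  show "h (z k) \<ge> 1 - \<delta>" if k: "k < i"
  proof -
    have "(\<Sum>j<i. h (z j)) = h (z k) + (\<Sum>j\<in>{..<i} - {k}. h (z j))"
      using k by (intro sum.remove) auto
    also have "(\<Sum>j\<in>{..<i} - {k}. h (z j)) \<le> (\<Sum>j\<in>{..<i} - {k}. 1)"
      using hz by (intro sum_mono) auto
    also have "(\<Sum>j\<in>{..<i} - {k}. (1::real)) = real i - 1"
      using k by simp
    finally show ?thesis
      using sum eq blinfun_unit_le[OF h, of v] by linarith
  qed
qed

text \<open>One functional \<open>f\<close> has to test \<open>v\<close> and all late
  \<open>z n\<close> at once, so the limit in \<open>i\<close> is taken first, for fixed
  \<open>k\<close>, and only then the limit along \<open>z n\<close>. The losses at \<open>v\<close>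
  and at \<open>u\<close> give \<open>2 * \<delta>\<close>.\<close>

lemma cluster_point_norm_ge:
  fixes z :: "nat \<Rightarrow> 'a::real_normed_vector" and u :: "('a \<Rightarrow>\<^sub>L real) \<Rightarrow>\<^sub>L real"
  assumes z: "\<And>k. norm (z k) \<le> 1"
    and u: "\<And>f C. closed C \<Longrightarrow> (\<forall>\<^sub>F n in sequentially. blinfun_apply f (z n) \<in> C) \<Longrightarrow> u f \<in> C"
    and sums: "\<And>i. norm (v + (\<Sum>k<i. z (N + k))) \<ge> norm v + real i - \<delta>"
  shows "norm (canonical_embedding v + u) \<ge> norm v + 1 - 2 * \<delta>"
proof -
  have "\<forall>i. \<exists>h. norm h \<le> 1 \<and>
      blinfun_apply h (v + (\<Sum>k<i. z (N + k))) = norm (v + (\<Sum>k<i. z (N + k)))"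
    by (meson exists_norming_functional)
  then obtain h :: "nat \<Rightarrow> 'a \<Rightarrow>\<^sub>L real" where h: "\<And>i. norm (h i) \<le> 1"
    "\<And>i. h i (v + (\<Sum>k<i. z (N + k))) = norm (v + (\<Sum>k<i. z (N + k)))"
    by metis
  have hv: "h i v \<ge> norm v - \<delta>" and hz: "k < i \<Longrightarrow> h i (z (N + k)) \<ge> 1 - \<delta>" for i k
    using norming_functional_of_sum[of "h i" i "\<lambda>k. z (N + k)" v \<delta>] h z sums by auto
  obtain f :: "'a \<Rightarrow>\<^sub>L real" where f: "norm f \<le> 1"
    and f_cl: "\<And>x C. closed C \<Longrightarrow> (\<forall>\<^sub>F n in sequentially. h n x \<in> C) \<Longrightarrow> f x \<in> C"
    using weak_star_cluster_point[of h, OF h(1)] by blast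
  have fv: "f v \<ge> norm v - \<delta>"
    using f_cl[of "{norm v - \<delta>..}" v] hv by simp
  have "f (z (N + k)) \<ge> 1 - \<delta>" for k
  proof -
    \<comment> \<open>\<open>z (N + k)\<close> is a term of the sum normed by \<open>h i\<close>
      only for \<open>i > k\<close>.\<close>
    have "\<forall>\<^sub>F i in sequentially. h i (z (N + k)) \<in> {1 - \<delta>..}"
      using eventually_gt_at_top[of k] by (rule eventually_mono) (simp add: hz)
    then show ?thesis using f_cl[of "{1 - \<delta>..}" "z (N + k)"] by simp
  qed
  then have "\<forall>\<^sub>F n in sequentially. f (z n) \<in> {1 - \<delta>..}"
    unfolding eventually_sequentially by (auto simp: le_iff_add)
  then have "u f \<ge> 1 - \<delta>"
    using u[of "{1 - \<delta>..}" f] by simp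
  then have "(canonical_embedding v + u) f \<ge> norm v + 1 - 2 * \<delta>"
    using fv by (simp add: blinfun.add_left)
  also have "(canonical_embedding v + u) f \<le> norm (canonical_embedding v + u)"
    using norm_blinfun[of "canonical_embedding v + u" f]
      mult_left_le[OF f norm_ge_zero, of "canonical_embedding v + u"] by simp
  finally show ?thesis .
qed

text \<open>The \<open>g n\<close> may have any norm, so that this serves both the sequence on the
  sphere and the functionals that determine a weak* neighbourhood.\<close>

lemma exists_L_orthogonal:
  fixes T :: "'a::real_normed_vector \<Rightarrow>\<^sub>L 'b::real_normed_vector" and g :: "nat \<Rightarrow> ('a \<Rightarrow>\<^sub>L real)"
  assumes nonzero: "\<exists>x::'a. x \<noteq> 0"
    and separable: "separable_space (euclidean :: 'a topology)"
    and narrow: "narrow T" and y: "norm y \<le> 1"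
  obtains u :: "('a \<Rightarrow>\<^sub>L real) \<Rightarrow>\<^sub>L real"
  where "norm u = 1" and "\<And>x. norm (canonical_embedding x + u) = 1 + norm x"
    and "biadjoint T u = canonical_embedding (T y)" and "\<And>n. u (g n) = g n y"
proof -
  obtain D :: "'a set" where D: "countable D" "closure D = UNIV"
    using separable by (auto simp: separable_space_def)
  have "D \<noteq> {}" using D(2) by auto
  define d where "d = from_nat_into D"
  have d: "range d = D" unfolding d_def using \<open>D \<noteq> {}\<close> D(1) by (rule range_from_nat_into)
  define p where "p n x = norm (T x) + (\<Sum>i<n. \<bar>g i x\<bar>)" for n x
  \<comment> \<open>The errors from stage \<open>N\<close> on add up to
    \<open>(1/2)^N\<close>.\<close>
  define e where "e n = (1/2::real) ^ Suc n" for n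
  have e_pos: "e n > 0" for n by (simp add: e_def)
  have p: "narrow_seminorm (p n)" for n
    unfolding p_def[abs_def]
    by (rule narrow_seminorm_add_sum[OF narrow_imp_narrow_seminorm[OF narrow nonzero]])
  \<comment> \<open>With \<open>finite V\<close> under the quantifier, \<open>Z\<close> is a total
    choice function and \<open>V\<close> can be defined by plain recursion.\<close>
  have "\<forall>n V. \<exists>z. finite V \<longrightarrow> norm z \<le> 1 \<and> p n (y - z) < e n \<and>
      (\<forall>v\<in>V. norm (v + z) > norm v + 1 - e n)"
    using narrow_seminorm_finite[OF _ p y e_pos] by blast
  then obtain Z where Z: "\<And>n V. finite V \<Longrightarrow> norm (Z n V) \<le> 1 \<and> p n (y - Z n V) < e n \<and>
      (\<forall>v\<in>V. norm (v + Z n V) > norm v + 1 - e n)"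
    by metis
  \<comment> \<open>Stage \<open>m\<close> treats \<open>d 0\<close> to \<open>d m\<close> together
    with all sums begun at earlier stages, which \<open>z m\<close> then prolongs.\<close>
  define V where "V = rec_nat {d 0} (\<lambda>m V. insert (d (Suc m)) (V \<union> (\<lambda>v. v + Z m V) ` V))"
  have V_0: "V 0 = {d 0}"
    and V_Suc: "V (Suc m) = insert (d (Suc m)) (V m \<union> (\<lambda>v. v + Z m (V m)) ` V m)" for m
    by (simp_all add: V_def)
  have fin: "finite (V m)" for m
    by (induction m) (auto simp: V_0 V_Suc)
  define z where "z m = Z m (V m)" for m
  have z_norm: "norm (z m) \<le> 1" and z_p: "p m (y - z m) < e m"
    and z_V: "v \<in> V m \<Longrightarrow> norm (v + z m) > norm v + 1 - e m" for m v
    using Z[OF fin] by (auto simp: z_def)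
  have d_V: "d j \<in> V N" if "j \<le> N" for j N
    using that by (induction N) (auto simp: V_0 V_Suc le_Suc_eq)
  have sum_V: "v + (\<Sum>k<i. z (N + k)) \<in> V (N + i)" if "v \<in> V N" for v N i
  proof (induction i)
    case (Suc i)
    have "v + (\<Sum>k<Suc i. z (N + k)) = (v + (\<Sum>k<i. z (N + k))) + z (N + i)"
      by (simp add: add.assoc)
    then show ?case using Suc by (auto simp: V_Suc z_def)
  qed (use that in simp)
  \<comment> \<open>The last term is the error budget still unspent: \<open>e (N + i)\<close> is
    exactly half of it.\<close>
  have sum_norm: "norm (v + (\<Sum>k<i. z (N + k))) \<ge> norm v + real i - (1/2)^N + (1/2)^(N + i)"
    if "v \<in> V N" for v N i
  proof (induction i)
    case (Suc i)
    have "norm (v + (\<Sum>k<i. z (N + k))) + 1 - e (N + i) < norm ((v + (\<Sum>k<i. z (N + k))) + z (N + i))"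
      by (rule z_V[OF sum_V[OF that]])
    then show ?case using Suc by (simp add: e_def add.assoc)
  qed simp
  obtain u :: "('a \<Rightarrow>\<^sub>L real) \<Rightarrow>\<^sub>L real" where u: "norm u \<le> 1"
    and u_cl: "\<And>f C. closed C \<Longrightarrow> (\<forall>\<^sub>F n in sequentially. blinfun_apply f (z n) \<in> C) \<Longrightarrow> u f \<in> C"
    using weak_star_cluster_point[of "\<lambda>n. canonical_embedding (z n)",
        OF order_trans[OF norm_canonical_embedding_le z_norm]] by auto
  \<comment> \<open>The values \<open>f (z n)\<close> converge to \<open>f y\<close>, so
    \<open>u f\<close> lies in every closed ball around \<open>f y\<close>. \<open>c\<close> will be
    \<open>norm f\<close> for the biadjoint; \<open>N\<close> is there because \<open>g i\<close>
    enters \<open>p n\<close> only for \<open>n > i\<close>.\<close>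
  have u_eq: "u f = f y" if bound: "\<And>n. n \<ge> N \<Longrightarrow> \<bar>f (y - z n)\<bar> \<le> c * e n" for f :: "'a \<Rightarrow>\<^sub>L real" and N c
  proof -
    have "(\<lambda>n. c * e n) \<longlonglongrightarrow> 0"
      unfolding e_def power_Suc by (intro tendsto_mult_right_zero LIMSEQ_power_zero) simp
    moreover have "\<forall>\<^sub>F n in sequentially. norm (f (y - z n)) \<le> c * e n"
      using bound by (intro eventually_sequentiallyI[of N]) simp
    ultimately have "(\<lambda>n. f (y - z n)) \<longlonglongrightarrow> 0"
      by (rule Lim_null_comparison[rotated])
    then have "(\<lambda>n. f (z n)) \<longlonglongrightarrow> f y"
      using tendsto_diff[OF tendsto_const[of "f y"], of "\<lambda>n. f (y - z n)" 0 sequentially]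
      by (simp add: blinfun.diff_right)
    then have ev: "\<forall>\<^sub>F n in sequentially. dist (f (z n)) (f y) < r" if "r > 0" for r
      using that by (rule tendstoD)
    have "dist (f y) (u f) \<le> 0 + r" if "r > 0" for r
    proof -
      have "\<forall>\<^sub>F n in sequentially. f (z n) \<in> cball (f y) r"
        using ev[OF that] by (rule eventually_mono) (simp add: dist_commute)
      then show ?thesis using u_cl[of "cball (f y) r" f] by simp
    qed
    then have "dist (f y) (u f) \<le> 0" by (rule field_le_epsilon)
    then show ?thesis by simp
  qed
  have T_le: "norm (T (y - z n)) < e n" for n
  proof -
    have "(\<Sum>i<n. \<bar>g i (y - z n)\<bar>) \<ge> 0" by (intro sum_nonneg) auto
    then show ?thesis using z_p[of n] unfolding p_def by linarith
  qed
  have g_le: "\<bar>g i (y - z n)\<bar> \<le> 1 * e n" if "n \<ge> Suc i" for i n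
  proof -
    have "\<bar>g i (y - z n)\<bar> \<le> (\<Sum>i<n. \<bar>g i (y - z n)\<bar>)"
      using that by (intro member_le_sum) auto
    then show ?thesis using z_p[of n] norm_ge_zero[of "T (y - z n)"] unfolding p_def by linarith
  qed
  have biadj: "biadjoint T u = canonical_embedding (T y)"
  proof (rule blinfun_eqI)
    fix f :: "'b \<Rightarrow>\<^sub>L real"
    have "\<bar>(f o\<^sub>L T) (y - z n)\<bar> \<le> norm f * e n" for n
      using norm_blinfun[of f "T (y - z n)"] mult_left_mono[OF less_imp_le[OF T_le[of n]] norm_ge_zero[of f]]
      by simp
    from u_eq[OF this] show "biadjoint T u f = canonical_embedding (T y) f"
      by (simp add: biadjoint_def)
  qed
  have ge_d: "norm (canonical_embedding x + u) \<ge> norm x + 1" if "x \<in> D" for x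
  proof -
    obtain j where j: "x = d j" using \<open>x \<in> D\<close> d by blast
    \<comment> \<open>Every later start \<open>N\<close> is allowed, since \<open>V N\<close> still
      contains \<open>d j\<close>; the loss then tends to 0.\<close>
    have ge: "norm (canonical_embedding x + u) \<ge> norm x + 1 - 2 * (1/2)^N" if "j \<le> N" for N
    proof (rule cluster_point_norm_ge[OF z_norm u_cl])
      show "norm x + real i - (1/2)^N \<le> norm (x + (\<Sum>k<i. z (N + k)))" for i
        using sum_norm[OF d_V[OF that], of i] zero_le_power[of "1/2::real" "N + i"]
        unfolding j by linarith
    qed
    have "(\<lambda>N. norm x + 1 - 2 * (1/2)^N) \<longlonglongrightarrow> norm x + 1 - 0"
      by (intro tendsto_diff tendsto_const tendsto_mult_right_zero LIMSEQ_power_zero) simp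
    then show ?thesis
      using ge by (intro LIMSEQ_le_const2[of _ "norm x + 1"]) auto
  qed
  have lin: "canonical_embedding x - canonical_embedding w = canonical_embedding (x - w)" for x w :: 'a
    by (rule blinfun_eqI) (simp add: blinfun.bilinear_simps)
  \<comment> \<open>Both sides are 1-Lipschitz in \<open>x\<close>, so the bound passes from the
    dense set to all \<open>x\<close>.\<close>
  have ge: "norm (canonical_embedding x + u) \<ge> norm x + 1" for x
  proof (rule field_le_epsilon)
    fix r :: real assume "r > 0"
    then obtain w where w: "w \<in> D" "dist w x < r/2"
      using D(2) closure_approachable[of x D] by (metis UNIV_I half_gt_zero)
    have "norm (canonical_embedding w + u) \<le>
        norm (canonical_embedding x + u) + norm (canonical_embedding (w - x))"
      using norm_triangle_ineq[of "canonical_embedding x + u" "canonical_embedding (w - x)"]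
      by (simp add: add.commute flip: lin)
    moreover have "norm (canonical_embedding (w - x)) < r/2"
      using norm_canonical_embedding_le[of "w - x"] w(2) by (simp add: dist_norm)
    moreover have "norm x \<le> norm w + r/2"
      using norm_triangle_ineq2[of x w] w(2) by (simp add: dist_norm norm_minus_commute)
    ultimately show "norm x + 1 \<le> norm (canonical_embedding x + u) + r"
      using ge_d[OF w(1)] by linarith
  qed
  have le: "norm (canonical_embedding x + u) \<le> norm x + 1" for x
    using norm_triangle_ineq[of "canonical_embedding x" u] norm_canonical_embedding_le[of x] u
    by linarith
  have "canonical_embedding (0::'a) = 0"
    by (rule blinfun_eqI) (simp add: blinfun.zero_right)
  with ge[of 0] u have "norm u = 1" by simp
  moreover have "norm (canonical_embedding x + u) = 1 + norm x" for x
    using ge[of x] le[of x] by linarith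
  moreover have "u (g n) = g n y" for n
    using u_eq[of "Suc n" "g n" 1] g_le by blast
  ultimately show ?thesis using biadj that by blast
qed

text \<open>A basic open set restricts only finitely many coordinates. Exact agreement there is
  asked for, as this is what the construction of \<open>u\<close> delivers.\<close>

lemma weak_star_open_contains_basis:
  fixes W :: "('v::real_normed_vector \<Rightarrow>\<^sub>L real) set"
  assumes "openin weak_star_topology W" "\<phi> \<in> W"
  obtains F where "finite F" "\<And>u. (\<And>f. f \<in> F \<Longrightarrow> blinfun_apply u f = \<phi> f) \<Longrightarrow> u \<in> W"
proof -
  obtain O' :: "('v \<Rightarrow> real) set" where O': "open O'" "W = blinfun_apply -` O'"
    using assms(1) by (auto simp: strong_operator_topology_def openin_pullback_topology)
  then have "openin (product_topology (\<lambda>_. euclidean) UNIV) O'"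
    by (simp add: euclidean_product_topology)
  moreover have "blinfun_apply \<phi> \<in> O'" using assms(2) O' by simp
  ultimately obtain X where X: "blinfun_apply \<phi> \<in> (\<Pi>\<^sub>E i\<in>UNIV. X i)"
    "finite {i. X i \<noteq> UNIV}" "(\<Pi>\<^sub>E i\<in>UNIV. X i) \<subseteq> O'"
    using product_topology_open_contains_basis[of "\<lambda>_. euclidean" UNIV O' "blinfun_apply \<phi>"] by auto
  show ?thesis
  proof (rule that[OF X(2)])
    fix u :: "'v \<Rightarrow>\<^sub>L real"
    assume "\<And>f. f \<in> {i. X i \<noteq> UNIV} \<Longrightarrow> u f = \<phi> f"
    then have "u f \<in> X f" for f
      using X(1) by (cases "X f = UNIV") (auto simp: PiE_iff)
    then have "blinfun_apply u \<in> (\<Pi>\<^sub>E i\<in>UNIV. X i)"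
      by (simp add: PiE_iff)
    then show "u \<in> W" using X(3) O'(2) by blast
  qed
qed

theorem theorem4p3:
  fixes T :: "'a::banach \<Rightarrow>\<^sub>L 'b::banach"
  assumes nonzero: "\<exists>x::'a. x \<noteq> 0"
    and separable: "separable_space (euclidean :: 'a topology)"
    and narrow: "narrow T"
  shows
    "(\<forall>y \<in> cball (0::'a) 1. \<forall>g :: nat \<Rightarrow> ('a \<Rightarrow>\<^sub>L real). range g \<subseteq> sphere 0 1 \<longrightarrow>
        (\<exists>u \<in> sphere (0 :: ('a \<Rightarrow>\<^sub>L real) \<Rightarrow>\<^sub>L real) 1.
          (\<forall>x::'a. norm (canonical_embedding x + u) = 1 + norm x) \<and>
          blinfun_apply (biadjoint T) u = canonical_embedding (blinfun_apply T y) \<and>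
          (\<forall>n. blinfun_apply u (g n) = blinfun_apply (g n) y)))
     \<and>
     (\<forall>y \<in> cball (0::'a) 1. \<forall>W :: (('a \<Rightarrow>\<^sub>L real) \<Rightarrow>\<^sub>L real) set.
        openin (subtopology weak_star_topology (cball 0 1)) W \<and> canonical_embedding y \<in> W \<longrightarrow>
        (\<exists>u \<in> W.
          (\<forall>x::'a. norm (canonical_embedding x + u) = 1 + norm x) \<and>
          blinfun_apply (biadjoint T) u = canonical_embedding (blinfun_apply T y)))"
proof (intro conjI ballI allI impI)
  fix y :: 'a and g :: "nat \<Rightarrow> ('a \<Rightarrow>\<^sub>L real)"
  assume "y \<in> cball 0 1"
  then have "norm y \<le> 1" by simp
  then obtain u :: "('a \<Rightarrow>\<^sub>L real) \<Rightarrow>\<^sub>L real" where "norm u = 1"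
    "\<And>x. norm (canonical_embedding x + u) = 1 + norm x"
    "biadjoint T u = canonical_embedding (T y)" "\<And>n. u (g n) = g n y"
    using exists_L_orthogonal[OF nonzero separable narrow] by metis
  then show "\<exists>u \<in> sphere (0 :: ('a \<Rightarrow>\<^sub>L real) \<Rightarrow>\<^sub>L real) 1.
      (\<forall>x::'a. norm (canonical_embedding x + u) = 1 + norm x) \<and>
      blinfun_apply (biadjoint T) u = canonical_embedding (blinfun_apply T y) \<and>
      (\<forall>n. blinfun_apply u (g n) = blinfun_apply (g n) y)"
    by (intro bexI[of _ u]) auto
next
  fix y :: 'a and W :: "(('a \<Rightarrow>\<^sub>L real) \<Rightarrow>\<^sub>L real) set"
  assume "y \<in> cball 0 1"
    and W: "openin (subtopology weak_star_topology (cball 0 1)) W \<and> canonical_embedding y \<in> W"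
  then have y: "norm y \<le> 1" by simp
  obtain U where U: "openin weak_star_topology U" "W = U \<inter> cball 0 1"
    using W by (auto simp: openin_subtopology)
  with W have "canonical_embedding y \<in> U" by simp
  then obtain F where F: "finite F"
    "\<And>u. (\<And>f. f \<in> F \<Longrightarrow> blinfun_apply u f = canonical_embedding y f) \<Longrightarrow> u \<in> U"
    using weak_star_open_contains_basis[OF U(1)] by metis
  \<comment> \<open>Inserting \<open>0\<close> gives a nonempty set to enumerate even if
    \<open>F\<close> is empty.\<close>
  define g where "g = from_nat_into (insert 0 F)"
  have range_g: "range g = insert 0 F"
    unfolding g_def using F(1) by (intro range_from_nat_into) (auto intro: countable_finite)
  obtain u :: "('a \<Rightarrow>\<^sub>L real) \<Rightarrow>\<^sub>L real" where u: "norm u = 1"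
    "\<And>x. norm (canonical_embedding x + u) = 1 + norm x"
    "biadjoint T u = canonical_embedding (T y)" "\<And>n. u (g n) = g n y"
    using exists_L_orthogonal[OF nonzero separable narrow y] by metis
  have "u f = canonical_embedding y f" if "f \<in> F" for f
  proof -
    have "f \<in> range g" using that range_g by simp
    then show ?thesis using u(4) by auto
  qed
  then have "u \<in> W" using F(2) U(2) u(1) by simp
  then show "\<exists>u \<in> W. (\<forall>x::'a. norm (canonical_embedding x + u) = 1 + norm x) \<and>
      blinfun_apply (biadjoint T) u = canonical_embedding (blinfun_apply T y)"
    using u by blast
qed

end
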